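(* Let $m\ge2$ and let $[a,b]$ ($a\ge b$) be an imaginary positive reduced root of $\mathcal H(m)$ with level $L\ge 2$, and let $\boldsymbol c_k=(a_{k,1},a_{k,2},\dots,a_{k,d_k})$ be its canonical sequences for $2\le k\le L$. In $W(m)$, writing $i$ for $s_i$: (1) If $k=2l+2$, then $$s^{a\times b}=(132)^l(21)^{a_{k,1}}(31)(21)^{a_{k,2}}(31)\cdots(21)^{a_{k,d_k}}(31)(231)^l.$$ (2) If $k=2l+1$, then $$s^{a\times b}=(132)^l(23)^{a_{k,1}+1}(21)(23)^{a_{k,2}+1}(21)\cdots(23)^{a_{k,d_k}+1}(21)(231)^l.$$ Moreover, $(231)^l s^{a\times b}(132)^l=s^{\tilde a\times\tilde b}$ for $[\tilde a,\tilde b]$ whose first canonical sequence is $(a_{k,1}+1,\dots,a_{k,d_k}+1)$, with level $L-k+1$.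
   Context: $W(m)=\langle s_1,s_2,s_3 : s_1^2=s_2^2=s_3^2=(s_1s_2)^m=(s_2s_3)^m=e\rangle$; products of simple reflections are written by their subscripts, e.g. $23=s_2s_3$. $\mathcal H(m)$ is the rank 2 Kac--Moody algebra with Cartan matrix $\begin{pmatrix}2&-m\\-m&2\end{pmatrix}$; $[a,b]$ denotes an element of its root lattice, $[1,0],[0,1]$ being the positive simple roots. A root $[a,b]$ is reduced if $\gcd(a,b)=1$, $ab\ne0$. For coprime positive integers $a,b$: $[a,b]$ is a root iff $a^2+b^2-mab\le1$, and it is imaginary (non-real) iff $a^2+b^2-mab\le 0$. For $a\ge b$, $\mathcal D^{a\times b}$ is the lattice path (unit steps right and up) from $(0,0)$ to $(a,b)$ as close as possible to the diagonal without ever going above it. $s^{a\times b}\in W(m)$ is the product, in the order along the path, of $s_2s_3$ for each horizontal edge and $s_2s_1$ for each vertical edge. Canonical sequences of a reduced positive root $[a,b]$ with $a\ge b$. Write $\mathcal D^{a\times b}=h^{a_{1,1}}vh^{a_{1,2}}v\cdots h^{a_{1,b}}v$ ($h$ horizontal, $v$ vertical edge); set $\boldsymbol c_1=(a_{1,1},\dots,a_{1,d_1})$, $d_1=b$, and $a/b=N_1+\rho_1$ with $N_1=\lfloor a/b\rfloor$. A finite sequence with all entries in $\{N,N+1\}$ is: of type $0$ if its length is $1$; if its length is $>1$, of type $=$ if no two consecutive entries are equal, of type $+$ if it is not of type $=$ and $(N,N)$ does not occur as consecutive entries, of type $-$ if it is not of type $=$ and $(N+1,N+1)$ does not occur as consecutive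 entries. The sequence $\boldsymbol c_n$ has entries in $\{N_n,N_n+1\}$ and its type is taken with $N=N_n$. Inductively for $n\ge2$: if $\boldsymbol c_{n-1}$ is of type $=$ or $0$, stop. Otherwise $\boldsymbol c_n=(a_{n,1},\dots,a_{n,d_n})$ is the sequence of lengths of the successive maximal runs of $(N_{n-1}+1)$'s in $\boldsymbol c_{n-1}$ if it is of type $+$, or of $N_{n-1}$'s if it is of type $-$; and the integer $N_n\geq 1$ and rational $0\le\rho_n<1$ are defined by $N_n+\rho_n=\frac{\rho_{n-1}}{1-\rho_{n-1}}$ if $\rho_{n-1}\ge\frac12$, $N_n+\rho_n=\frac{1-\rho_{n-1}}{\rho_{n-1}}$ if $\rho_{n-1}<\frac12$. Level. Let $\gamma_0=0$, $\gamma_1=m-\frac12$, $\gamma_n=m-\frac1{\gamma_{n-1}}$ for $n\ge2$. The level of an imaginary reduced positive root $[a,b]$ with $a\ge b$ is the unique positive integer $L$ with $\gamma_{L-1}<\frac ab\le\gamma_L$. *)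

theory Defs
  imports Complex_Main "HOL-Algebra.Group" "HOL-Library.Sublist"
begin

section \<open>The group \<open>W(m)\<close>\<close>

datatype gen = S1 | S2 | S3

definition relators :: "nat \<Rightarrow> gen list set" where
  "relators m = {[S1, S1], [S2, S2], [S3, S3],
     concat (replicate m [S1, S2]), concat (replicate m [S2, S3])}"

text \<open>
  Since every generator has order dividing two, words in the generators alone
  (without formal inverses) suffice: the group presented by the relators is the
  quotient of the free monoid by the congruence that identifies every relator with
  the empty word.
\<close>

inductive word_equiv :: "nat \<Rightarrow> gen list \<Rightarrow> gen list \<Rightarrow> bool" for m where
  relator: "r \<in> relators m \<Longrightarrow> word_equiv m (u @ r @ v) (u @ v)"
| refl: "word_equiv m u u"
| sym: "word_equiv m u v \<Longrightarrow> word_equiv m v u"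
| trans: "word_equiv m u v \<Longrightarrow> word_equiv m v w \<Longrightarrow> word_equiv m u w"

definition word_rel :: "nat \<Rightarrow> (gen list \<times> gen list) set" where
  "word_rel m = {(u, v). word_equiv m u v}"

definition W :: "nat \<Rightarrow> gen list set monoid" where
  "W m = \<lparr>carrier = UNIV // word_rel m,
          mult = (\<lambda>X Y. \<Union>x\<in>X. \<Union>y\<in>Y. word_rel m `` {x @ y}),
          one = word_rel m `` {[]}\<rparr>"

definition s :: "nat \<Rightarrow> gen \<Rightarrow> gen list set" where
  "s m i = word_rel m `` {[i]}"

text \<open>Ordered product of a list of elements of a monoid.\<close>

definition list_prod :: "('a, 'b) monoid_scheme \<Rightarrow> 'a list \<Rightarrow> 'a" where
  "list_prod G xs = foldr (\<lambda>x y. x \<otimes>\<^bsub>G\<^esub> y) xs \<one>\<^bsub>G\<^esub>"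

definition w :: "nat \<Rightarrow> gen list \<Rightarrow> gen list set" where
  "w m is = list_prod (W m) (map (s m) is)"

lemma equiv_word_rel: "equiv UNIV (word_rel m)"
  by (rule equivI)
    (auto simp: word_rel_def refl_on_def sym_def trans_def intro: word_equiv.intros)

lemma word_equiv_append:
  assumes "word_equiv m u u'" "word_equiv m v v'"
  shows "word_equiv m (u @ v) (u' @ v')"
proof -
  have 1: "word_equiv m (x @ u @ y) (x @ u' @ y)" if "word_equiv m u u'" for x y u u'
    using that
  proof induction
    case (relator r u v)
    then show ?case using word_equiv.relator[of r m "x @ u" "v @ y"] by simp
  qed (auto intro: word_equiv.intros)
  from 1[OF assms(1), of "[]" v] 1[OF assms(2), of u' "[]"] show ?thesis
    by (auto intro: word_equiv.trans)
qed

lemma mult_class: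
  "(word_rel m `` {u}) \<otimes>\<^bsub>W m\<^esub> (word_rel m `` {v}) = word_rel m `` {u @ v}"
proof -
  have "word_rel m `` {x @ y} = word_rel m `` {u @ v}"
    if "x \<in> word_rel m `` {u}" "y \<in> word_rel m `` {v}" for x y
  proof -
    have "(u @ v, x @ y) \<in> word_rel m"
      using that by (auto simp: word_rel_def intro: word_equiv_append)
    then show ?thesis using equiv_class_eq[OF equiv_word_rel] by metis
  qed
  moreover have "u \<in> word_rel m `` {u}" "v \<in> word_rel m `` {v}"
    by (auto simp: word_rel_def intro: word_equiv.refl)
  ultimately show ?thesis unfolding W_def monoid.simps by blast
qed

lemma carrier_class: "word_rel m `` {u} \<in> carrier (W m)"
  by (simp add: W_def quotientI)

lemma carrierE: assumes "x \<in> carrier (W m)" obtains u where "x = word_rel m `` {u}"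
  using assms by (auto simp: W_def elim: quotientE)

lemma one_class: "\<one>\<^bsub>W m\<^esub> = word_rel m `` {[]}"
  by (simp add: W_def)

lemma w_class: "w m is = word_rel m `` {is}"
  by (induction "is") (simp_all add: w_def list_prod_def one_class s_def mult_class)

lemma class_eqI: "word_equiv m u v \<Longrightarrow> word_rel m `` {u} = word_rel m `` {v}"
  by (rule equiv_class_eq[OF equiv_word_rel]) (simp add: word_rel_def)

lemma rev_inverse: "word_equiv m (rev u @ u) []"
proof (induction u)
  case (Cons i u)
  have "[i, i] \<in> relators m" by (cases i) (auto simp: relators_def)
  from word_equiv.relator[OF this, of "rev u" u] Cons show ?case
    by (auto intro: word_equiv.trans)
qed (auto intro: word_equiv.refl)

lemma group_W: "group (W m)"
proof (rule groupI)
  fix x assume "x \<in> carrier (W m)"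
  then obtain u where x: "x = word_rel m `` {u}" by (rule carrierE)
  have "(word_rel m `` {rev u}) \<otimes>\<^bsub>W m\<^esub> x = \<one>\<^bsub>W m\<^esub>"
    unfolding x mult_class one_class by (rule class_eqI[OF rev_inverse])
  then show "\<exists>y\<in>carrier (W m). y \<otimes>\<^bsub>W m\<^esub> x = \<one>\<^bsub>W m\<^esub>"
    using carrier_class by blast
qed (auto elim!: carrierE simp: mult_class carrier_class one_class)

lemma relator_one: "r \<in> relators m \<Longrightarrow> w m r = \<one>\<^bsub>W m\<^esub>"
  using word_equiv.relator[of r m "[]" "[]"] by (simp add: w_class one_class class_eqI)

text \<open>Universal property of the presentation (uniqueness of \<open>h\<close> is clear from \<open>w_class\<close>).\<close>

lemma W_universal:
  assumes "group G" and f: "\<And>i. f i \<in> carrier G"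
    and rel: "\<And>r. r \<in> relators m \<Longrightarrow> list_prod G (map f r) = \<one>\<^bsub>G\<^esub>"
  shows "\<exists>h\<in>hom (W m) G. \<forall>i. h (s m i) = f i"
proof -
  interpret group G by fact
  define p where "p u = list_prod G (map f u)" for u
  have p_closed: "p u \<in> carrier G" for u
    by (induction u) (auto simp: p_def list_prod_def f)
  have p_app: "p (u @ v) = p u \<otimes>\<^bsub>G\<^esub> p v" for u v
  proof (induction u)
    case Nil
    then show ?case using p_closed[of v] by (simp add: p_def list_prod_def)
  next
    case (Cons i u)
    then show ?case using p_closed[of u] p_closed[of v] f[of i]
      by (simp add: p_def list_prod_def m_assoc)
  qed
  have p_eq: "p u = p v" if "word_equiv m u v" for u v
    using that
  proof induction
    case (relator r u v)
    then have "p r = \<one>\<^bsub>G\<^esub>" using rel by (simp add: p_def)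
    then show ?case by (simp add: p_app p_closed)
  qed auto
  define h where "h X = p (SOME u. u \<in> X)" for X
  have h: "h (word_rel m `` {u}) = p u" for u
  proof -
    have "u \<in> word_rel m `` {u}" by (auto simp: word_rel_def intro: word_equiv.refl)
    then have "(SOME v. v \<in> word_rel m `` {u}) \<in> word_rel m `` {u}" by (rule someI)
    then show ?thesis unfolding h_def by (auto simp: word_rel_def dest: p_eq)
  qed
  have "h \<in> hom (W m) G"
    by (auto simp: hom_def h p_closed mult_class p_app elim!: carrierE)
  moreover have "h (s m i) = f i" for i
    using f[of i] by (simp add: s_def h p_def list_prod_def)
  ultimately show ?thesis by blast
qed


section \<open>Roots of \<open>\<H>(m)\<close>\<close>

text \<open>
  For coprime positive integers \<open>a\<close>, \<open>b\<close>, the lattice element \<open>[a, b]\<close> is a root of the rank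
  two Kac--Moody algebra \<open>\<H>(m)\<close> iff \<open>a\<^sup>2 + b\<^sup>2 - m a b \<le> 1\<close>, and this root is imaginary iff
  the form is nonpositive.  (The form is half the invariant form of the Cartan matrix.)
\<close>

definition root_form :: "nat \<Rightarrow> nat \<Rightarrow> nat \<Rightarrow> int" where
  "root_form m a b = (int a)\<^sup>2 + (int b)\<^sup>2 - int m * int a * int b"

definition reduced_positive_root :: "nat \<Rightarrow> nat \<Rightarrow> nat \<Rightarrow> bool" where
  "reduced_positive_root m a b \<longleftrightarrow>
     a > 0 \<and> b > 0 \<and> coprime a b \<and> root_form m a b \<le> 1"

definition imaginary_reduced_positive_root :: "nat \<Rightarrow> nat \<Rightarrow> nat \<Rightarrow> bool" where
  "imaginary_reduced_positive_root m a b \<longleftrightarrow>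
     reduced_positive_root m a b \<and> root_form m a b \<le> 0"


section \<open>The path \<open>\<D>\<^bsup>a\<times>b\<^esup>\<close> and the element \<open>s\<^bsup>a\<times>b\<^esup>\<close>\<close>

datatype edge = H | V

definition lattice_path :: "nat \<Rightarrow> nat \<Rightarrow> edge list \<Rightarrow> bool" where
  "lattice_path a b p \<longleftrightarrow> count_list p H = a \<and> count_list p V = b"

text \<open>The lattice point reached after \<open>n\<close> edges is \<open>(x, y)\<close> with
  \<open>x = count_list (take n p) H\<close> and \<open>y = count_list (take n p) V\<close>; it is not above the diagonal
  of the \<open>a \<times> b\<close> rectangle iff \<open>a y \<le> b x\<close>.\<close>

definition below_diagonal :: "nat \<Rightarrow> nat \<Rightarrow> edge list \<Rightarrow> bool" where
  "below_diagonal a b p \<longleftrightarrow>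
     (\<forall>n. a * count_list (take n p) V \<le> b * count_list (take n p) H)"

text \<open>Among the paths that stay below the diagonal, being closest to it means that after every
  number of edges the point reached is at least as high as that of any other such path.\<close>

definition is_dyck_path :: "nat \<Rightarrow> nat \<Rightarrow> edge list \<Rightarrow> bool" where
  "is_dyck_path a b p \<longleftrightarrow>
     lattice_path a b p \<and> below_diagonal a b p \<and>
     (\<forall>q. lattice_path a b q \<and> below_diagonal a b q \<longrightarrow>
        (\<forall>n. count_list (take n q) V \<le> count_list (take n p) V))"

definition dyck_path :: "nat \<Rightarrow> nat \<Rightarrow> edge list" where
  "dyck_path a b = (THE p. is_dyck_path a b p)"

lemma length_count: "length p = count_list p H + count_list p V"
proof (induction p)
  case (Cons x p) then show ?case by (cases x) auto
qed auto

lemma is_dyck_path_unique: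
  assumes "is_dyck_path a b p" "is_dyck_path a b q"
  shows "p = q"
proof (rule nth_equalityI)
  have e: "count_list (take n p) V = count_list (take n q) V" for n
    using assms by (meson is_dyck_path_def order_antisym)
  show len: "length p = length q"
    using assms by (simp add: length_count is_dyck_path_def lattice_path_def)
  fix i assume i: "i < length p"
  have "count_list (take (Suc i) p) V = count_list (take (Suc i) q) V"
    "count_list (take i p) V = count_list (take i q) V" by (rule e)+
  then have "(p ! i = V) = (q ! i = V)"
    using i len by (auto simp: take_Suc_conv_app_nth split: if_splits)
  then show "p ! i = q ! i" by (cases "p ! i"; cases "q ! i") auto
qed

text \<open>The point reached after \<open>n\<close> edges of \<open>\<D>\<^bsup>a\<times>b\<^esup>\<close> has height \<open>\<lfloor>b n / (a + b)\<rfloor>\<close>.\<close>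

lemma is_dyck_path_explicit:
  assumes "a + b > 0"
  shows "is_dyck_path a b
    (map (\<lambda>n. if b * n div (a + b) < b * Suc n div (a + b) then V else H) [0..<a + b])"
    (is "is_dyck_path a b ?p")
proof -
  let ?h = "\<lambda>n. b * n div (a + b)"
  have step: "?h (Suc n) = ?h n \<or> ?h (Suc n) = Suc (?h n)" for n
  proof -
    have "?h n \<le> ?h (Suc n)" by (rule div_le_mono) simp
    moreover have "?h (Suc n) \<le> (b * n + (a + b)) div (a + b)" by (rule div_le_mono) simp
    moreover have "(b * n + (a + b)) div (a + b) = Suc (?h n)"
      using assms by simp
    ultimately show ?thesis by linarith
  qed
  have cnt: "count_list (take n ?p) V = ?h n" if "n \<le> a + b" for n
    using that
  proof (induction n)
    case (Suc n)
    then have "count_list (take (Suc n) ?p) V =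
        ?h n + (if ?h n < ?h (Suc n) then 1 else 0)"
      by (simp add: take_Suc_conv_app_nth)
    with step[of n] show ?case by auto
  qed simp
  have len: "length ?p = a + b" by simp
  have full: "?h (a + b) = b" using assms by simp
  have V: "count_list ?p V = b" using cnt[of "a + b"] full len by simp
  then have lp: "lattice_path a b ?p"
    using length_count[of ?p] by (simp add: lattice_path_def)
  have cnt': "count_list (take n q) V + count_list (take n q) H = min n (a + b)"
    if "lattice_path a b q" for n q
    using that length_count[of q] length_count[of "take n q"]
    by (simp add: lattice_path_def)
  have char: "(a * v \<le> b * h) \<longleftrightarrow> v \<le> ?h (v + h)" for v h
    using assms by (simp add: less_eq_div_iff_mult_less_eq algebra_simps)
  have cmin: "count_list (take n ?p) V = ?h (min n (a + b))" for n
    using cnt[of "min n (a + b)"] by (cases "n \<le> a + b") (simp_all add: min_def)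
  have bd: "below_diagonal a b ?p"
    unfolding below_diagonal_def char cnt'[OF lp] unfolding cmin by simp
  have "count_list (take n q) V \<le> count_list (take n ?p) V"
    if "lattice_path a b q" "below_diagonal a b q" for q n
    using that(2) unfolding below_diagonal_def char cnt'[OF that(1)] cmin by blast
  with lp bd show ?thesis unfolding is_dyck_path_def by blast
qed

lemma dyck_path_explicit:
  assumes "a + b > 0"
  shows "dyck_path a b =
    map (\<lambda>n. if b * n div (a + b) < b * Suc n div (a + b) then V else H) [0..<a + b]"
  unfolding dyck_path_def
  by (rule the_equality) (use is_dyck_path_explicit[OF assms] is_dyck_path_unique in blast)+

fun edge_word :: "edge \<Rightarrow> gen list" where
  "edge_word H = [S2, S3]"
| "edge_word V = [S2, S1]"

definition s_path :: "nat \<Rightarrow> nat \<Rightarrow> nat \<Rightarrow> gen list set" where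
  "s_path m a b = list_prod (W m) (map (\<lambda>e. w m (edge_word e)) (dyck_path a b))"


section \<open>Canonical sequences\<close>

fun h_lengths_aux :: "nat \<Rightarrow> edge list \<Rightarrow> nat list" where
  "h_lengths_aux n [] = []"
| "h_lengths_aux n (H # p) = h_lengths_aux (Suc n) p"
| "h_lengths_aux n (V # p) = n # h_lengths_aux 0 p"

text \<open>The list \<open>[x\<^sub>1, \<dots>, x\<^sub>d]\<close> with \<open>p = h\<^bsup>x\<^sub>1\<^esup> v \<dots> h\<^bsup>x\<^sub>d\<^esup> v\<close>, for a path \<open>p\<close> ending
  with a vertical edge.\<close>

definition h_lengths :: "edge list \<Rightarrow> nat list" where
  "h_lengths p = h_lengths_aux 0 p"

lemma h_lengths_concat:
  "h_lengths (concat (map (\<lambda>x. replicate x H @ [V]) xs)) = xs"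
proof -
  have 1: "h_lengths_aux n (replicate x H @ V # p) = (n + x) # h_lengths_aux 0 p" for n x p
    by (induction x arbitrary: n) auto
  show ?thesis unfolding h_lengths_def by (induction xs) (auto simp: 1)
qed

definition type_0 :: "nat list \<Rightarrow> bool" where
  "type_0 c \<longleftrightarrow> length c = 1"

definition type_eq :: "nat list \<Rightarrow> bool" where
  "type_eq c \<longleftrightarrow> length c > 1 \<and> distinct_adj c"

definition type_plus :: "nat \<Rightarrow> nat list \<Rightarrow> bool" where
  "type_plus N c \<longleftrightarrow> length c > 1 \<and> \<not> type_eq c \<and> \<not> sublist [N, N] c"

definition type_minus :: "nat \<Rightarrow> nat list \<Rightarrow> bool" where
  "type_minus N c \<longleftrightarrow> length c > 1 \<and> \<not> type_eq c \<and> \<not> sublist [N + 1, N + 1] c"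

text \<open>Lengths of the successive maximal runs of \<open>x\<close>.\<close>

function runs :: "nat \<Rightarrow> nat list \<Rightarrow> nat list" where
  "runs x [] = []"
| "runs x (y # ys) =
     (if y = x then Suc (length (takeWhile ((=) x) ys)) # runs x (dropWhile ((=) x) ys)
      else runs x ys)"
  by pat_completeness auto
termination
  by (relation "measure (length \<circ> snd)") (auto simp: le_imp_less_Suc length_dropWhile_le)

text \<open>\<open>N\<^sub>n + \<rho>\<^sub>n\<close> as a function of \<open>\<rho>\<^sub>n\<^sub>-\<^sub>1\<close>.\<close>

definition next_slope :: "rat \<Rightarrow> rat" where
  "next_slope \<rho> = (if \<rho> \<ge> 1/2 then \<rho> / (1 - \<rho>) else (1 - \<rho>) / \<rho>)"

text \<open>The triple \<open>(c\<^sub>n, N\<^sub>n, \<rho>\<^sub>n)\<close>, or \<open>None\<close> if the construction has stopped before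
  stage \<open>n\<close>; indices start at \<open>1\<close>.\<close>

fun canonical_data :: "nat \<Rightarrow> nat \<Rightarrow> nat \<Rightarrow> (nat list \<times> nat \<times> rat) option" where
  "canonical_data a b 0 = None"
| "canonical_data a b (Suc 0) =
     (let x = of_nat a / of_nat b
      in Some (h_lengths (dyck_path a b), nat \<lfloor>x\<rfloor>, frac x))"
| "canonical_data a b (Suc (Suc n)) =
     (case canonical_data a b (Suc n) of
        None \<Rightarrow> None
      | Some (c, N, \<rho>) \<Rightarrow>
          let x = next_slope \<rho> in
          if type_eq c \<or> type_0 c then None
          else if type_plus N c then Some (runs (N + 1) c, nat \<lfloor>x\<rfloor>, frac x)
          else if type_minus N c then Some (runs N c, nat \<lfloor>x\<rfloor>, frac x)
          else None)"

definition canonical_seq :: "nat \<Rightarrow> nat \<Rightarrow> nat \<Rightarrow> nat list option" where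
  "canonical_seq a b n = map_option fst (canonical_data a b n)"


section \<open>Level\<close>

fun gam :: "nat \<Rightarrow> nat \<Rightarrow> rat" where
  "gam m 0 = 0"
| "gam m (Suc 0) = of_nat m - 1/2"
| "gam m (Suc (Suc n)) = of_nat m - 1 / gam m (Suc n)"

definition is_level :: "nat \<Rightarrow> nat \<Rightarrow> nat \<Rightarrow> nat \<Rightarrow> bool" where
  "is_level m a b L \<longleftrightarrow>
     L > 0 \<and> gam m (L - 1) < of_nat a / of_nat b \<and> of_nat a / of_nat b \<le> gam m L"

definition level :: "nat \<Rightarrow> nat \<Rightarrow> nat \<Rightarrow> nat" where
  "level m a b = (THE L. is_level m a b L)"

lemma gam_ge_1: "m \<ge> 2 \<Longrightarrow> gam m (Suc n) \<ge> 1"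
proof (induction n)
  case 0
  then have "(2::rat) \<le> of_nat m" by (metis of_nat_le_iff of_nat_numeral)
  then show ?case by simp
next
  case (Suc n)
  then have "(2::rat) \<le> of_nat m" by (metis of_nat_le_iff of_nat_numeral)
  moreover have "1 / gam m (Suc n) \<le> 1" using Suc by simp
  ultimately show ?case by simp
qed

lemma gam_mono: assumes "m \<ge> 3" shows "mono (gam m)"
proof -
  have m3: "(3::rat) \<le> of_nat m" using assms by (metis of_nat_le_iff of_nat_numeral)
  have pos: "gam m (Suc n) \<ge> 1" for n using gam_ge_1[of m n] assms by simp
  have "gam m n \<le> gam m (Suc n)" for n
  proof (induction n rule: gam.induct[where ?P = "\<lambda>_ n. gam m n \<le> gam m (Suc n)"])
    case (2 k)
    have "1 / gam m (Suc 0) \<le> 1 / 2" using m3 by (simp add: field_simps)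
    then show ?case by simp
  next
    case (3 k n)
    then have "1 / gam m (Suc (Suc n)) \<le> 1 / gam m (Suc n)"
      using pos[of n] by (intro divide_left_mono mult_pos_pos) (auto intro: less_le_trans)
    then show ?case by simp
  qed (use m3 in auto)
  then show ?thesis by (simp add: mono_iff_le_Suc)
qed

lemma ex_gam_ge:
  assumes m: "m \<ge> 2" and "b > 0" "a \<ge> b" "root_form m a b \<le> 0"
  shows "\<exists>n. of_nat a / of_nat b \<le> gam m n"
  using assms(2-)
proof (induction "a + b" arbitrary: a b rule: less_induct)
  case less
  have m2: "(2::rat) \<le> of_nat m" using m by (metis of_nat_le_iff of_nat_numeral)
  show ?case
  proof (cases "of_nat a / of_nat b \<le> gam m (Suc 0)")
    case True then show ?thesis by blast
  next
    case False
    have b: "(0::rat) < of_nat b" using less.prems by simp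
    have form: "int a * int a + int b * int b \<le> int m * int a * int b"
      using less.prems by (simp add: root_form_def power2_eq_square)
    have "int a * int a < int a * (int m * int b)"
    proof -
      have "0 < int b * int b" using less.prems by simp
      then show ?thesis using form by (simp add: mult_ac)
    qed
    then have "int a < int m * int b" using less.prems by (simp add: mult_less_cancel_left)
    then have lt: "a < m * b" by (metis of_nat_less_iff of_nat_mult)
    define c where "c = m * b - a"
    have c0: "c > 0" using lt by (simp add: c_def)
    have ci: "int c = int m * int b - int a" using lt by (simp add: c_def of_nat_diff)
    have cr: "(of_nat c :: rat) = of_nat m * of_nat b - of_nat a"
      using lt by (simp add: c_def of_nat_diff)
    have "of_nat m - 1/2 < (of_nat a / of_nat b :: rat)" using False by simp
    then have "(of_nat m - 1/2) * of_nat b < (of_nat a :: rat)"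
      using b by (simp add: pos_less_divide_eq)
    then have "2 * (of_nat c :: rat) < of_nat b" unfolding cr by (simp add: algebra_simps)
    then have "(of_nat (2 * c) :: rat) < of_nat b" by simp
    then have cb: "2 * c < b" by (simp only: of_nat_less_iff)
    have "root_form m b c = root_form m a b"
      unfolding root_form_def ci by (simp add: power2_eq_square algebra_simps)
    with less.prems less.hyps[of b c] c0 cb
    obtain n where n: "of_nat b / of_nat c \<le> gam m n" by auto
    have cp: "(0::rat) < of_nat c" using c0 by simp
    then have gp: "0 < gam m n" using n b by (meson divide_pos_pos less_le_trans)
    then obtain k where k: "n = Suc k" by (cases n) auto
    have "1 / gam m n \<le> 1 / (of_nat b / of_nat c)"
      using n b cp gp by (intro divide_left_mono) auto
    also have "\<dots> = of_nat m - of_nat a / of_nat b"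
      using b cr by (simp add: field_simps)
    finally have "of_nat a / of_nat b \<le> gam m (Suc n)" by (simp add: k)
    then show ?thesis by blast
  qed
qed

lemma is_level_unique:
  assumes m: "m \<ge> 2" and b: "b > 0" "a \<ge> b" and im: "root_form m a b \<le> 0"
    and "is_level m a b L" "is_level m a b L'"
  shows "L \<le> L'"
proof (rule ccontr)
  assume "\<not> L \<le> L'"
  then have LL: "L' \<le> L - 1" "L' > 0" "L - 1 > 0" using assms(6) by (auto simp: is_level_def)
  have lt: "gam m (L - 1) < of_nat a / of_nat b" and le: "of_nat a / of_nat b \<le> gam m L'"
    using assms(5,6) by (auto simp: is_level_def)
  show False
  proof (cases "m = 2")
    case True
    have "root_form m a b = (int a - int b)\<^sup>2"
      by (simp add: True root_form_def power2_eq_square algebra_simps)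
    with im have "a = b" by simp
    with b lt have "gam m (L - 1) < 1" by simp
    moreover obtain j where "L - 1 = Suc j" using LL(3) by (cases "L - 1") auto
    ultimately show False using gam_ge_1[OF m, of j] by simp
  next
    case False
    with m have "mono (gam m)" by (intro gam_mono) simp
    from monoD[OF this LL(1)] lt le show False by linarith
  qed
qed

lemma ex1_level:
  assumes m: "m \<ge> 2" and im: "imaginary_reduced_positive_root m a b" and ab: "a \<ge> b"
  shows "\<exists>!L. is_level m a b L"
proof -
  have b: "b > 0" "root_form m a b \<le> 0"
    using im by (auto simp: imaginary_reduced_positive_root_def reduced_positive_root_def)
  let ?P = "\<lambda>n. of_nat a / of_nat b \<le> gam m n"
  obtain n where n: "?P n" using ex_gam_ge[OF m b(1) ab b(2)] by blast
  define L where "L = (LEAST n. ?P n)"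
  have PL: "?P L" unfolding L_def using n by (rule LeastI)
  have "(0::rat) < of_nat a / of_nat b" using b ab by simp
  with PL have "L > 0" by (cases L) auto
  then have "\<not> ?P (L - 1)" unfolding L_def by (intro not_less_Least) simp
  with PL \<open>L > 0\<close> have "is_level m a b L" by (simp add: is_level_def)
  moreover have "L' = L''" if "is_level m a b L'" "is_level m a b L''" for L' L''
    using is_level_unique[OF m b(1) ab b(2)] that by (meson order_antisym)
  ultimately show ?thesis by blast
qed

end

theory Submission
  imports Defs
begin

text \<open>
  Everything is governed by the reflection \<open>[a, b] \<mapsto> [b, c]\<close> with \<open>c = m b - a\<close>, which preserves
  the quadratic form and coprimality.  Since \<open>b / c = 1 / (m - a / b)\<close>, the recursion
  \<open>\<gamma>\<^sub>n = m - 1 / \<gamma>\<^sub>n\<^sub>-\<^sub>1\<close> is exactly what makes the level drop by one (\<open>reflect_root\<close>).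

  On the combinatorial side, the first canonical sequence of \<open>[a, b]\<close> is the sequence of gaps
  \<open>\<lceil>a (j + 1) / b\<rceil> - \<lceil>a j / b\<rceil>\<close>.  If the level is at least two, then \<open>a / b > m - 1/2\<close>, so
  \<open>2 c < b\<close>; substituting \<open>a = m b - c\<close> turns the ceilings into \<open>m j - \<lfloor>c j / b\<rfloor>\<close>, and the
  sequence is \<open>m\<close> except at the \<open>c\<close> places where the floor jumps, where it is \<open>m - 1\<close>.  The
  distances between these places are the gaps of \<open>[b, c]\<close>, so every entry \<open>x\<close> of the first
  canonical sequence of \<open>[b, c]\<close> contributes \<open>m, \<dots>, m, m - 1\<close> with \<open>x - 1\<close> copies of \<open>m\<close>
  (\<open>ceil_gaps_reflect\<close>).  All \<open>x\<close> are at least two and some \<open>x\<close> is at least three, so the type is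
  \<open>+\<close> and the next canonical sequence is that of \<open>[b, c]\<close> with all entries lowered by one.  Types
  and runs only depend on which of the two values an entry takes, so by iteration the \<open>k\<close>-th
  canonical sequence is the first one of the \<open>(k - 1)\<close>-fold reflected root, lowered by one, for
  \<open>2 \<le> k \<le> L\<close> (\<open>governs_step\<close>).

  On the group side, put \<open>x = 23\<close> and \<open>y = 21\<close>.  The path gives a factor \<open>x\<^sup>n y\<close> for each entry \<open>n\<close>
  of the first canonical sequence.  As \<open>x\<^sup>m = e\<close>, an entry \<open>m\<close> contributes \<open>y\<close> and an entry
  \<open>m - 1\<close> contributes \<open>x\<^sup>-\<^sup>1 y = 31\<close>; this is the formula for \<open>k = 2\<close>.  As \<open>y\<^sup>m = e\<close> too, one more
  reflection gives factors \<open>y\<^sup>-\<^sup>1 31\<close> and \<open>y\<^sup>-\<^sup>2 31\<close>, and these are the conjugates of \<open>x\<close> and \<open>x y\<close>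
  by \<open>132\<close>.  Hence two reflections together conjugate \<open>s\<^bsup>a\<times>b\<^esup>\<close> (\<open>s_path_reflect_twice\<close>), and
  both formulas follow by descending two levels at a time (\<open>descent\<close>).
\<close>

section \<open>Gaps of a Beatty sequence\<close>

text \<open>The ceiling of \<open>p j / q\<close>, for \<open>q > 0\<close>.\<close>

definition ceil_div :: "nat \<Rightarrow> nat \<Rightarrow> nat \<Rightarrow> nat" where
  "ceil_div p q j = (p * j + (q - 1)) div q"

definition ceil_gaps :: "nat \<Rightarrow> nat \<Rightarrow> nat list" where
  "ceil_gaps p q = map (\<lambda>j. ceil_div p q (Suc j) - ceil_div p q j) [0..<q]"

lemma less_ceil_div_iff:
  assumes "q > 0" shows "n < ceil_div p q j \<longleftrightarrow> q * n < p * j"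
proof -
  have "n < ceil_div p q j \<longleftrightarrow> Suc n * q \<le> p * j + (q - 1)"
    unfolding ceil_div_def less_eq_div_iff_mult_less_eq[OF assms, symmetric] by auto
  also have "\<dots> \<longleftrightarrow> q * n < p * j" using assms by (auto simp: algebra_simps)
  finally show ?thesis .
qed

lemma ceil_div_le_iff:
  assumes "q > 0" shows "ceil_div p q j \<le> n \<longleftrightarrow> p * j \<le> q * n"
  using less_ceil_div_iff[OF assms, of n p j] by linarith

lemma ceil_div_eqI:
  assumes "q > 0" "\<And>n. n < k \<longleftrightarrow> q * n < p * j"
  shows "ceil_div p q j = k"
  using less_ceil_div_iff[OF assms(1), of _ p j] assms(2) by (metis linorder_neqE_nat less_irrefl)

lemma ceil_div_0: "q > 0 \<Longrightarrow> ceil_div p q 0 = 0"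
  by (simp add: ceil_div_def)

lemma ceil_div_full: "q > 0 \<Longrightarrow> ceil_div p q q = p"
  by (rule ceil_div_eqI) (auto simp: mult.commute)

lemma ceil_div_add: "q > 0 \<Longrightarrow> ceil_div (p + q) q j = ceil_div p q j + j"
proof -
  assume "q > 0"
  then have "(p * j + (q - 1) + j * q) div q = (p * j + (q - 1)) div q + j"
    by (metis add.commute div_mult_self1 less_irrefl)
  then show ?thesis by (simp only: ceil_div_def algebra_simps)
qed

lemma ceil_div_Suc_ge:
  assumes "q > 0" "d * q \<le> p" shows "ceil_div p q j + d \<le> ceil_div p q (Suc j)"
proof -
  have "(p * j + (q - 1) + d * q) div q \<le> (p * Suc j + (q - 1)) div q"
    using assms(2) by (intro div_le_mono) simp
  moreover have "(p * j + (q - 1) + d * q) div q = (p * j + (q - 1)) div q + d"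
    using assms(1) by (metis add.commute div_mult_self1 less_irrefl)
  ultimately show ?thesis by (simp only: ceil_div_def)
qed

lemma ceil_div_le_Suc: "q > 0 \<Longrightarrow> ceil_div p q j \<le> ceil_div p q (Suc j)"
  using ceil_div_Suc_ge[of q 0 p j] by simp

lemma length_ceil_gaps: "length (ceil_gaps p q) = q"
  by (simp add: ceil_gaps_def)

lemma sum_list_ceil_gaps:
  assumes "q > 0" shows "sum_list (ceil_gaps p q) = p"
proof -
  have "sum_list (map (\<lambda>j. ceil_div p q (Suc j) - ceil_div p q j) [0..<n]) = ceil_div p q n" for n
    using ceil_div_le_Suc[OF assms, of p] by (induction n) (simp_all add: ceil_div_0 assms)
  then show ?thesis by (simp add: ceil_gaps_def ceil_div_full assms)
qed

lemma ceil_gaps_ge: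
  assumes "q > 0" "d * q \<le> p" "x \<in> set (ceil_gaps p q)" shows "d \<le> x"
  using assms(3) ceil_div_Suc_ge[OF assms(1,2)]
  by (auto simp: ceil_gaps_def le_diff_conv2 ceil_div_le_Suc assms(1) add.commute)

lemma ceil_gaps_add: "q > 0 \<Longrightarrow> ceil_gaps (p + q) q = map Suc (ceil_gaps p q)"
  using ceil_div_le_Suc[of q p] by (simp add: ceil_gaps_def ceil_div_add Suc_diff_le)

lemma map_upt_concat_blocks:
  assumes "u 0 = (0::nat)" "\<And>j. u j \<le> u (Suc j)"
  shows "map f [0..<u k] = concat (map (\<lambda>j. map f [u j..<u (Suc j)]) [0..<k])"
proof (induction k)
  case (Suc k)
  have "[0..<u (Suc k)] = [0..<u k] @ [u k..<u (Suc k)]"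
    using assms(2)[of k] by (metis le_add_diff_inverse upt_add_eq_append zero_le)
  with Suc show ?case by simp
qed (simp add: assms)

text \<open>
  The function \<open>n \<mapsto> \<lfloor>q n / p\<rfloor>\<close> is constantly \<open>j\<close> from \<open>\<lceil>p j / q\<rceil>\<close> up to just before
  \<open>\<lceil>p (j + 1) / q\<rceil>\<close>.  So the lengths of its constant stretches are the gaps of the
  inverse slope, and each stretch consists of steps \<open>0\<close> followed by one step \<open>1\<close>.  With horizontal
  and vertical edges as values of \<open>F\<close> this describes the lattice path; with \<open>m\<close> and
  \<open>m - 1\<close> it describes how the canonical sequences of a root and of its reflection are related.
\<close>

lemma map_floor_steps:
  assumes q: "0 < q" "q \<le> p"
  shows "map (\<lambda>n. F (q * Suc n div p - q * n div p)) [0..<p] =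
    concat (map (\<lambda>x. replicate (x - 1) (F 0) @ [F (Suc 0)]) (ceil_gaps p q))"
proof -
  let ?u = "ceil_div p q"
  let ?f = "\<lambda>n. F (q * Suc n div p - q * n div p)"
  have floor: "q * n div p = j" if "?u j \<le> n" "n < ?u (Suc j)" for j n
  proof (rule div_nat_eqI)
    show "p * j \<le> q * n" using that(1) ceil_div_le_iff[OF q(1)] by simp
    show "q * n < p * Suc j" using that(2) less_ceil_div_iff[OF q(1)] by blast
  qed
  have lt: "?u j < ?u (Suc j)" for j using ceil_div_Suc_ge[of q 1 p j] q by simp
  have block: "map ?f [?u j..<?u (Suc j)] =
      replicate (?u (Suc j) - ?u j - 1) (F 0) @ [F (Suc 0)]" for j
  proof -
    obtain e where e: "?u (Suc j) = Suc e" using lt[of j] by (cases "?u (Suc j)") auto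
    have le: "?u j \<le> e" using lt[of j] e by simp
    have "?f n = F 0" if "?u j \<le> n" "n < e" for n
      using floor[of j n] floor[of j "Suc n"] that e by simp
    then have "map ?f [?u j..<e] = map (\<lambda>_. F 0) [?u j..<e]" by (intro map_cong) auto
    moreover have "?f e = F (Suc 0)"
      using floor[of j e] floor[of "Suc j" "Suc e"] e le lt[of "Suc j"] by simp
    ultimately show ?thesis using e le by (simp add: map_replicate_const)
  qed
  have "map ?f [0..<?u q] = concat (map (\<lambda>j. map ?f [?u j..<?u (Suc j)]) [0..<q])"
    by (rule map_upt_concat_blocks) (simp_all add: ceil_div_0 ceil_div_le_Suc q)
  then show ?thesis unfolding block ceil_div_full[OF q(1)]
    by (simp add: ceil_gaps_def o_def)
qed

text \<open>
  After \<open>n\<close> edges the path has height \<open>\<lfloor>b n / (a + b)\<rfloor>\<close>.  The gaps of slope \<open>(a + b) / b\<close> count the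
  edges up to and including each vertical one, hence exceed the numbers of horizontal edges by one.
\<close>

lemma dyck_path_ceil_gaps:
  assumes "b > 0"
  shows "dyck_path a b = concat (map (\<lambda>x. replicate x H @ [V]) (ceil_gaps a b))"
proof -
  let ?F = "\<lambda>d::nat. if 0 < d then V else H"
  have "dyck_path a b = map (\<lambda>n. ?F (b * Suc n div (a + b) - b * n div (a + b))) [0..<a + b]"
    using dyck_path_explicit[of a b] assms by (simp del: mult_Suc_right)
  also have "\<dots> = concat (map (\<lambda>x. replicate (x - 1) H @ [V]) (ceil_gaps (a + b) b))"
    by (subst map_floor_steps) (use assms in auto)
  finally show ?thesis using assms by (simp add: ceil_gaps_add o_def)
qed

lemma h_lengths_dyck_path: "b > 0 \<Longrightarrow> h_lengths (dyck_path a b) = ceil_gaps a b"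
  by (simp add: dyck_path_ceil_gaps h_lengths_concat)

text \<open>
  The entries of \<open>xs\<close> are the lengths of whole blocks, including the closing \<open>N\<close>.  The runs of
  \<open>N + 1\<close> are shorter by one, and this is the origin of the shift between the canonical
  sequences of a root and those of its reflections.
\<close>

definition blocks :: "nat \<Rightarrow> nat list \<Rightarrow> nat list" where
  "blocks N xs = concat (map (\<lambda>x. replicate (x - 1) (Suc N) @ [N]) xs)"

text \<open>
  From \<open>a = (N + 1) b - c\<close> one gets \<open>\<lceil>a i / b\<rceil> = (N + 1) i - \<lfloor>c i / b\<rfloor>\<close>, so a gap is \<open>N\<close> or
  \<open>N + 1\<close> according to whether the floor jumps, and the jumps are spaced by the gaps of \<open>[b, c]\<close>.
\<close>

lemma ceil_gaps_reflect:
  assumes "0 < c" "c \<le> b" "a + c = Suc N * b"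
  shows "ceil_gaps a b = blocks N (ceil_gaps b c)"
proof -
  have b: "b > 0" using assms by simp
  have le: "c * i div b \<le> i" for i
    using div_le_mono[of "c * i" "b * i" b] assms(2) b by simp
  have up: "ceil_div a b i = Suc N * i - c * i div b" for i
  proof (rule ceil_div_eqI[OF b])
    fix n
    have eq: "a * i + c * i = Suc N * i * b"
      using assms(3) by (metis add_mult_distrib mult.assoc mult.commute)
    have "n < Suc N * i - c * i div b \<longleftrightarrow> n + c * i div b < Suc N * i" by linarith
    also have "\<dots> \<longleftrightarrow> c * i div b < Suc N * i - n" by linarith
    also have "\<dots> \<longleftrightarrow> c * i < (Suc N * i - n) * b"
      using b by (rule div_less_iff_less_mult)
    also have "\<dots> \<longleftrightarrow> b * n < a * i"
      unfolding diff_mult_distrib eq[symmetric] using mult.commute[of n b] by linarith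
    finally show "n < Suc N * i - c * i div b \<longleftrightarrow> b * n < a * i" .
  qed
  have step: "ceil_div a b (Suc i) - ceil_div a b i = Suc N - (c * Suc i div b - c * i div b)" for i
  proof -
    have "c * i div b \<le> c * Suc i div b" by (rule div_le_mono) simp
    moreover have "c * i div b \<le> Suc N * i" using le[of i] by (rule order_trans) simp
    moreover have "c * Suc i div b \<le> Suc (c * i div b)"
      using div_le_mono[of "c * Suc i" "c * i + b" b] assms(2) b by simp
    ultimately show ?thesis unfolding up by (simp only: mult_Suc_right)
  qed
  have "ceil_gaps a b = map (\<lambda>i. Suc N - (c * Suc i div b - c * i div b)) [0..<b]"
    unfolding ceil_gaps_def step ..
  also have "\<dots> = blocks N (ceil_gaps b c)"
    by (subst map_floor_steps) (use assms in \<open>auto simp: blocks_def\<close>)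
  finally show ?thesis .
qed


section \<open>The type of a derived sequence\<close>

lemma blocks_simps:
  "blocks N [] = []"
  "blocks N (x # xs) = replicate (x - 1) (Suc N) @ N # blocks N xs"
  by (simp_all add: blocks_def)

lemma runs_blocks:
  assumes "\<forall>x\<in>set xs. 2 \<le> x"
  shows "runs (Suc N) (blocks N xs) = map (\<lambda>x. x - 1) xs"
  using assms
proof (induction xs)
  case (Cons x xs)
  then obtain y where y: "x = Suc (Suc y)" by (metis list.set_intros(1) add_2_eq_Suc le_Suc_ex)
  have "takeWhile ((=) (Suc N)) (replicate y (Suc N) @ N # zs) = replicate y (Suc N)"
    "dropWhile ((=) (Suc N)) (replicate y (Suc N) @ N # zs) = N # zs" for zs
    by (induction y) auto
  with Cons y show ?case by (simp add: blocks_simps)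
qed (simp add: blocks_simps)

lemma blocks_no_repeat:
  assumes "\<forall>x\<in>set xs. 2 \<le> x" shows "\<not> sublist [N, N] (blocks N xs)"
  using assms
proof (induction xs)
  case (Cons x xs)
  have rep: "sublist [N, N] (replicate k (Suc N) @ zs) = sublist [N, N] zs" for k zs
    by (induction k) (auto simp: sublist_Cons_right)
  have "\<not> prefix [N] (blocks N xs)"
  proof (cases xs)
    case (Cons y ys)
    with \<open>\<forall>x\<in>set (_ # xs). 2 \<le> x\<close> obtain z where "y = Suc (Suc z)"
      by (metis list.set_intros add_2_eq_Suc le_Suc_ex)
    with Cons show ?thesis by (simp add: blocks_simps)
  qed (simp add: blocks_simps)
  then show ?case using Cons by (simp add: blocks_simps rep sublist_Cons_right)
qed (simp add: blocks_simps)

lemma blocks_not_distinct_adj: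
  assumes "x \<in> set xs" "3 \<le> x" shows "\<not> distinct_adj (blocks N xs)"
proof -
  obtain ys zs where "xs = ys @ x # zs" using assms(1) by (meson split_list)
  moreover obtain k where "x = Suc (Suc (Suc k))"
    using assms(2) by (metis add_Suc numeral_3_eq_3 le_Suc_ex add_0)
  ultimately show ?thesis by (simp add: blocks_def distinct_adj_append_iff)
qed

lemma type_plus_blocks:
  assumes "\<forall>x\<in>set xs. 2 \<le> x" "x \<in> set xs" "3 \<le> x"
  shows "type_plus N (blocks N xs)"
proof -
  note nd = blocks_not_distinct_adj[OF assms(2,3), of N]
  have "length (blocks N xs) > 1"
  proof (rule ccontr)
    assume "\<not> ?thesis"
    then have "distinct_adj (blocks N xs)"
      by (cases "blocks N xs") auto
    with nd show False ..
  qed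
  with nd show ?thesis
    using blocks_no_repeat[OF assms(1)] by (simp add: type_plus_def type_eq_def)
qed

text \<open>
  Blocks of length at least two separate the \<open>N\<close>'s from each other, and a block of length at
  least three supplies two adjacent entries \<open>N + 1\<close>.  So the type is \<open>+\<close>, and the runs to
  be counted are the blocks without their final \<open>N\<close>.
\<close>

lemma canonical_step:
  assumes data: "canonical_data a b (Suc n) = Some (blocks N xs, N, \<rho>)"
    and xs: "\<forall>x\<in>set xs. 2 \<le> x" "x \<in> set xs" "3 \<le> x"
  shows "canonical_data a b (Suc (Suc n)) =
    Some (map (\<lambda>x. x - 1) xs, nat \<lfloor>next_slope \<rho>\<rfloor>, frac (next_slope \<rho>))"
proof -
  have tp: "type_plus N (blocks N xs)" using xs by (rule type_plus_blocks)
  then have "\<not> type_eq (blocks N xs)" "\<not> type_0 (blocks N xs)"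
    by (auto simp: type_plus_def type_0_def)
  with tp show ?thesis using data by (simp add: runs_blocks[OF xs(1)] Let_def)
qed


section \<open>Reflection of roots\<close>

definition root_of_level :: "nat \<Rightarrow> nat \<Rightarrow> nat \<Rightarrow> nat \<Rightarrow> bool" where
  "root_of_level m a b L \<longleftrightarrow>
     imaginary_reduced_positive_root m a b \<and> a \<ge> b \<and> is_level m a b L"

lemma root_of_level_pos: "root_of_level m a b L \<Longrightarrow> a > 0 \<and> b > 0 \<and> b \<le> a"
  by (simp add: root_of_level_def imaginary_reduced_positive_root_def reduced_positive_root_def)

lemma level_eq:
  assumes "m \<ge> 2" "root_of_level m a b L" shows "level m a b = L"
  unfolding level_def using assms ex1_level[of m a b]
  by (intro the1_equality) (auto simp: root_of_level_def)

lemma root_of_level_level: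
  assumes "m \<ge> 2" "imaginary_reduced_positive_root m a b" "a \<ge> b"
  shows "root_of_level m a b (level m a b)"
  unfolding root_of_level_def level_def using theI'[OF ex1_level[OF assms]] assms by simp

text \<open>
  The case \<open>m = 2\<close> is degenerate: its only imaginary reduced root is \<open>[1, 1]\<close>, of level one.  For
  larger \<open>m\<close> the \<open>\<gamma>\<^sub>n\<close> increase, and \<open>\<gamma>\<^sub>1 = m - 1/2\<close>.
\<close>

lemma slope_gt:
  assumes m: "m \<ge> 2" and r: "root_of_level m a b L" "L \<ge> 2"
  shows "of_nat m - 1/2 < (of_nat a / of_nat b :: rat)"
proof -
  have lt: "gam m (L - 1) < of_nat a / of_nat b"
    and im: "root_form m a b \<le> 0" "coprime a b" "a > 0" "b > 0"
    using r by (auto simp: root_of_level_def is_level_def imaginary_reduced_positive_root_def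
        reduced_positive_root_def)
  have "m \<noteq> 2"
  proof
    assume "m = 2"
    then have "root_form m a b = (int a - int b)\<^sup>2"
      by (simp add: root_form_def power2_eq_square algebra_simps)
    with im have "a = b" by simp
    with im lt have "gam m (L - 1) < 1" by simp
    moreover obtain j where "L - 1 = Suc j" using r(2) by (cases "L - 1") auto
    ultimately show False using gam_ge_1[OF m, of j] by simp
  qed
  with m have "gam m 1 \<le> gam m (L - 1)"
    using r(2) by (intro monoD[OF gam_mono]) auto
  with lt show ?thesis by simp
qed

text \<open>
  Both bounds defining the level are transported by \<open>b / c = 1 / (m - a / b)\<close>, the inverse of the
  recursion for \<open>\<gamma>\<close>.  The lower bound needs a separate argument when the new level is one, as
  \<open>\<gamma>\<^sub>1\<close> does not come from \<open>\<gamma>\<^sub>0\<close> by that recursion.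
\<close>

lemma reflect_root:
  assumes m: "m \<ge> 2" and r: "root_of_level m a b (Suc n)" and n: "n \<ge> 1"
  obtains c where "a + c = m * b" "2 * c < b" "root_of_level m b c n"
proof -
  have im: "root_form m a b \<le> 0" "coprime a b" and pos: "a > 0" "b > 0"
    and lev: "gam m n < of_nat a / of_nat b" "of_nat a / of_nat b \<le> gam m (Suc n)"
    using r by (auto simp: root_of_level_def is_level_def imaginary_reduced_positive_root_def
        reduced_positive_root_def)
  have bp: "(0::rat) < of_nat b" using pos by simp
  have "int a * int a < int a * (int m * int b)"
  proof -
    have "0 < int b * int b" using pos by simp
    then show ?thesis using im(1) by (simp add: root_form_def power2_eq_square mult_ac)
  qed
  then have "int a < int m * int b" using pos by (simp add: mult_less_cancel_left)
  then have lt: "a < m * b" by (metis of_nat_less_iff of_nat_mult)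
  then obtain c where c: "a + c = m * b" by (metis le_add_diff_inverse less_imp_le)
  with lt have c0: "c > 0" by simp
  have cr: "(of_nat a :: rat) = of_nat m * of_nat b - of_nat c"
    using c by (metis add_diff_cancel_right' of_nat_add of_nat_mult)
  have ci: "int c = int m * int b - int a" using c by (metis add_diff_cancel_left' of_nat_add of_nat_mult)
  have ab: "(of_nat a / of_nat b :: rat) = of_nat m - of_nat c / of_nat b"
    using bp unfolding cr by (simp add: field_simps)
  have cp: "(0::rat) < of_nat c" using c0 by simp
  have "2 * of_nat c < (of_nat b :: rat)"
    using slope_gt[OF m r] n bp unfolding ab by (simp add: field_simps)
  then have "(of_nat (2 * c) :: rat) < of_nat b" by simp
  then have cb: "2 * c < b" by (simp only: of_nat_less_iff)
  have form: "root_form m b c \<le> 0"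
    using im(1) unfolding root_form_def ci by (simp add: power2_eq_square algebra_simps)
  have "coprime b c"
  proof (rule coprimeI)
    fix d assume "d dvd b" "d dvd c"
    then have "d dvd a" using c by (metis dvd_add_left_iff dvd_mult)
    with \<open>d dvd b\<close> im(2) show "is_unit d" by (meson coprime_common_divisor)
  qed
  with form c0 pos cb have root: "imaginary_reduced_positive_root m b c"
    by (simp add: imaginary_reduced_positive_root_def reduced_positive_root_def)
  obtain j where j: "n = Suc j" using n by (cases n) auto
  have gp: "gam m (Suc i) > 0" for i using gam_ge_1[OF m, of i] by linarith
  have "of_nat b / of_nat c \<le> gam m n"
    using lev(2) gp[of j] bp cp unfolding ab j by (simp add: field_simps)
  moreover have "gam m (n - 1) < of_nat b / of_nat c"
  proof (cases j)
    case 0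
    then show ?thesis using bp cp j by simp
  next
    case (Suc i)
    then show ?thesis using lev(1) gp[of i] bp cp unfolding ab j by (simp add: field_simps)
  qed
  ultimately have "is_level m b c n" using n by (simp add: is_level_def)
  with root cb have "root_of_level m b c n" by (simp add: root_of_level_def)
  with c cb show ?thesis by (rule that)
qed

lemma ceil_gaps_reflect_root:
  assumes c: "a + c = m * b" "2 * c < b" "c > 0" and m: "m \<ge> 1"
  shows "ceil_gaps a b = blocks (m - 1) (ceil_gaps b c)"
    and "\<forall>x\<in>set (ceil_gaps b c). 2 \<le> x" and "\<exists>x\<in>set (ceil_gaps b c). 3 \<le> x"
proof -
  show "ceil_gaps a b = blocks (m - 1) (ceil_gaps b c)"
    using c m by (intro ceil_gaps_reflect) auto
  show "\<forall>x\<in>set (ceil_gaps b c). 2 \<le> x"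
    using c ceil_gaps_ge[of c 2 b] by auto
  \<comment> \<open>The \<open>c\<close> gaps add up to \<open>b > 2 c\<close>, so they cannot all be at most two.\<close>
  show "\<exists>x\<in>set (ceil_gaps b c). 3 \<le> x"
  proof (rule ccontr)
    assume "\<not> ?thesis"
    then have "sum_list (map (\<lambda>x. x) (ceil_gaps b c)) \<le> sum_list (map (\<lambda>_. 2) (ceil_gaps b c))"
      by (intro sum_list_mono) (auto simp: not_le)
    with c show False by (simp add: sum_list_ceil_gaps sum_list_triv length_ceil_gaps)
  qed
qed

text \<open>
  Here \<open>\<rho> = 1 - c / b > 1/2\<close>, so the first branch of the slope recursion applies and yields
  \<open>b / c - 1\<close>, in accordance with the lowering of the entries by one.
\<close>

lemma slope_reflect:
  assumes c: "a + c = m * b" "2 * c < b" "c > 0" and m: "m \<ge> 1"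
  shows "\<lfloor>of_nat a / of_nat b :: rat\<rfloor> = int m - 1"
    and "next_slope (frac (of_nat a / of_nat b)) = of_nat b / of_nat c - 1"
proof -
  have bp: "(0::rat) < of_nat b" and cp: "(0::rat) < of_nat c" using c by simp_all
  have c2: "2 * of_nat c < (of_nat b :: rat)"
    using c(2) by (metis of_nat_less_iff of_nat_mult of_nat_numeral)
  have cr: "(of_nat a :: rat) = of_nat m * of_nat b - of_nat c"
    using c(1) by (metis add_diff_cancel_right' of_nat_add of_nat_mult)
  have ab: "(of_nat a / of_nat b :: rat) = of_nat m - of_nat c / of_nat b"
    using bp unfolding cr by (simp add: field_simps)
  have q: "0 < (of_nat c / of_nat b :: rat)" "(of_nat c / of_nat b :: rat) < 1/2"
    "(of_nat c / of_nat b :: rat) \<le> 1"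
    using bp cp c2 by (simp_all add: field_simps)
  show fl: "\<lfloor>of_nat a / of_nat b :: rat\<rfloor> = int m - 1"
    unfolding ab using q by (intro floor_unique) auto
  have fr: "frac (of_nat a / of_nat b :: rat) = 1 - of_nat c / of_nat b"
    unfolding frac_def fl unfolding ab by simp
  have "next_slope (frac (of_nat a / of_nat b)) =
      (1 - of_nat c / of_nat b) / (1 - (1 - of_nat c / of_nat b) :: rat)"
    unfolding next_slope_def fr using q by simp
  also have "\<dots> = of_nat b / of_nat c - 1" using bp cp by (simp add: field_simps)
  finally show "next_slope (frac (of_nat a / of_nat b)) = of_nat b / of_nat c - 1" .
qed

text \<open>
  The data of the first stage for \<open>[p, q]\<close> with every entry, and hence the slope, lowered by one.
  This is the form that all later stages take.
\<close>

definition shifted_data :: "nat \<Rightarrow> nat \<Rightarrow> nat list \<times> nat \<times> rat" where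
  "shifted_data p q = (map (\<lambda>x. x - 1) (ceil_gaps p q),
     nat \<lfloor>of_nat p / of_nat q - 1 :: rat\<rfloor>, frac (of_nat p / of_nat q))"

lemma frac_diff_1: "frac (x - 1) = frac (x :: rat)"
  by (simp add: frac_def)

lemma canonical_data_2:
  assumes c: "a + c = m * b" "2 * c < b" "c > 0" and m: "m \<ge> 1"
  shows "canonical_data a b 2 = Some (shifted_data b c)"
proof -
  have "canonical_data a b (Suc 0) =
      Some (blocks (m - 1) (ceil_gaps b c), m - 1, frac (of_nat a / of_nat b))"
    using c m ceil_gaps_reflect_root(1)[OF c m]
    by (simp add: h_lengths_dyck_path slope_reflect(1)[OF c m] nat_diff_distrib Let_def)
  from canonical_step[OF this] ceil_gaps_reflect_root(2,3)[OF c m] show ?thesis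
    unfolding slope_reflect(2)[OF c m] by (auto simp: numeral_2_eq_2 shifted_data_def frac_diff_1)
qed

text \<open>
  Lowering a sequence of blocks in \<open>m - 1\<close> and \<open>m\<close> by one gives the same blocks in \<open>m - 2\<close> and
  \<open>m - 1\<close>, and lowering the slope by an integer keeps its fractional part.  So the next stage is
  the same whether or not the current one was lowered.
\<close>

lemma canonical_data_shift_step:
  assumes data: "canonical_data a b (Suc n) = Some (shifted_data p q)"
    and c: "p + c = m * q" "2 * c < q" "c > 0" and m: "m \<ge> 2"
  shows "canonical_data a b (Suc (Suc n)) = Some (shifted_data q c)"
proof -
  have m1: "m \<ge> 1" using m by simp
  have "map (\<lambda>x. x - 1) (blocks (m - 1) xs) = blocks (m - 2) xs" for xs
    using m by (induction xs) (auto simp: blocks_simps Suc_diff_Suc numeral_2_eq_2)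
  then have "shifted_data p q = (blocks (m - 2) (ceil_gaps q c), m - 2, frac (of_nat p / of_nat q))"
    using m slope_reflect(1)[OF c m1]
    by (simp add: shifted_data_def ceil_gaps_reflect_root(1)[OF c m1] nat_diff_distrib)
  with data have "canonical_data a b (Suc n) =
      Some (blocks (m - 2) (ceil_gaps q c), m - 2, frac (of_nat p / of_nat q))" by simp
  from canonical_step[OF this] ceil_gaps_reflect_root(2,3)[OF c m1] show ?thesis
    unfolding slope_reflect(2)[OF c m1] by (auto simp: shifted_data_def frac_diff_1)
qed


section \<open>Products in the group\<close>

context group
begin

lemma list_prod_simps:
  "list_prod G [] = \<one>" "list_prod G (x # xs) = x \<otimes> list_prod G xs"
  by (simp_all add: list_prod_def)

lemma list_prod_closed: "set xs \<subseteq> carrier G \<Longrightarrow> list_prod G xs \<in> carrier G"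
  by (induction xs) (auto simp: list_prod_simps)

lemma list_prod_append:
  "set xs \<subseteq> carrier G \<Longrightarrow> set ys \<subseteq> carrier G \<Longrightarrow>
    list_prod G (xs @ ys) = list_prod G xs \<otimes> list_prod G ys"
  by (induction xs) (auto simp: list_prod_simps list_prod_closed m_assoc)

lemma list_prod_replicate: "x \<in> carrier G \<Longrightarrow> list_prod G (replicate n x) = x [^] n"
  by (induction n) (simp_all only: replicate.simps list_prod_simps nat_pow_Suc2 nat_pow_0)

lemma list_prod_concat_blocks:
  assumes "\<And>e. f e \<in> carrier G"
  shows "list_prod G (map f (concat (map (\<lambda>x. replicate (g x) u @ [v]) xs))) =
    list_prod G (map (\<lambda>x. f u [^] g x \<otimes> f v) xs)"
proof (induction xs)
  case (Cons x xs)
  have "list_prod G (map f (concat (map (\<lambda>x. replicate (g x) u @ [v]) (x # xs)))) =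
      list_prod G (map f (replicate (g x) u @ [v])) \<otimes>
      list_prod G (map f (concat (map (\<lambda>x. replicate (g x) u @ [v]) xs)))"
    using assms by (subst list_prod_append[symmetric]) auto
  moreover have "list_prod G (map f (replicate (g x) u @ [v])) = f u [^] g x \<otimes> f v"
    using assms
    by (simp add: list_prod_append set_replicate_conv_if list_prod_simps list_prod_replicate)
  ultimately show ?case using Cons by (simp add: list_prod_simps)
qed (simp add: list_prod_simps)

lemma list_prod_conj:
  assumes "g \<in> carrier G" "\<And>x. x \<in> set xs \<Longrightarrow> f x \<in> carrier G"
  shows "list_prod G (map (\<lambda>x. g \<otimes> f x \<otimes> inv g) xs) = g \<otimes> list_prod G (map f xs) \<otimes> inv g"
  using assms(2)
proof (induction xs)
  case (Cons x xs)
  have "list_prod G (map f xs) \<in> carrier G" using Cons.prems by (intro list_prod_closed) auto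
  moreover have "inv g \<otimes> (g \<otimes> z) = z" if "z \<in> carrier G" for z
    using that assms(1) by (simp flip: m_assoc)
  ultimately show ?case using Cons assms(1) by (simp add: list_prod_simps m_assoc)
qed (simp add: list_prod_simps assms(1))

lemma conj_nat_pow:
  assumes "g \<in> carrier G" "x \<in> carrier G"
  shows "(g \<otimes> x \<otimes> inv g) [^] (n::nat) = g \<otimes> x [^] n \<otimes> inv g"
  using list_prod_conj[of g "replicate n x" "\<lambda>x. x"] assms
  by (simp add: list_prod_replicate map_replicate_const)

end

lemma (in group) pow_pred_eq_inv:
  assumes "x \<in> carrier G" "x [^] (m::nat) = \<one>" "m \<ge> 1" shows "x [^] (m - 1) = inv x"
proof -
  have "x [^] (m - 1) \<otimes> x = \<one>" using assms by (cases m) auto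
  then show ?thesis using assms(1) by (simp add: inv_equality[symmetric])
qed


section \<open>The reflection inside the group\<close>

lemma w_closed [simp]: "w m u \<in> carrier (W m)"
  by (simp add: w_class carrier_class)

lemma s_closed [simp]: "s m i \<in> carrier (W m)"
  by (simp add: s_def carrier_class)

lemma w_Nil: "w m [] = \<one>\<^bsub>W m\<^esub>"
  by (simp add: w_class one_class)

lemma w_Cons: "w m (i # u) = s m i \<otimes>\<^bsub>W m\<^esub> w m u"
  by (simp add: w_class s_def mult_class)

lemma w_append: "w m (u @ v) = w m u \<otimes>\<^bsub>W m\<^esub> w m v"
  by (simp add: w_class mult_class)

lemma w_pow: "w m u [^]\<^bsub>W m\<^esub> n = w m (concat (replicate n u))"
proof -
  interpret group "W m" by (rule group_W)
  show ?thesis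
    by (induction n) (simp_all only: nat_pow_0 nat_pow_Suc2[OF w_closed] replicate.simps
        concat.simps w_Nil w_append)
qed

lemma inv_w: "inv\<^bsub>W m\<^esub> (w m u) = w m (rev u)"
proof -
  interpret group "W m" by (rule group_W)
  have "w m (rev u) \<otimes>\<^bsub>W m\<^esub> w m u = \<one>\<^bsub>W m\<^esub>"
    by (simp add: w_class mult_class one_class class_eqI rev_inverse)
  then show ?thesis by (simp add: inv_equality)
qed

lemma s_square: "s m i \<otimes>\<^bsub>W m\<^esub> s m i = \<one>\<^bsub>W m\<^esub>"
proof -
  have "[i, i] \<in> relators m" by (cases i) (auto simp: relators_def)
  from relator_one[OF this] show ?thesis
    using group.is_monoid[OF group_W] by (simp add: w_Cons w_Nil monoid.r_one)
qed

lemma s_cancel: "x \<in> carrier (W m) \<Longrightarrow> s m i \<otimes>\<^bsub>W m\<^esub> (s m i \<otimes>\<^bsub>W m\<^esub> x) = x"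
proof -
  interpret group "W m" by (rule group_W)
  assume "x \<in> carrier (W m)"
  then show ?thesis by (simp add: s_square flip: m_assoc)
qed

lemma rotation_orders:
  shows "w m [S2, S3] [^]\<^bsub>W m\<^esub> m = \<one>\<^bsub>W m\<^esub>" and "w m [S2, S1] [^]\<^bsub>W m\<^esub> m = \<one>\<^bsub>W m\<^esub>"
proof -
  interpret group "W m" by (rule group_W)
  show "w m [S2, S3] [^]\<^bsub>W m\<^esub> m = \<one>\<^bsub>W m\<^esub>"
    unfolding w_pow by (rule relator_one) (simp add: relators_def)
  have "w m [S1, S2] [^]\<^bsub>W m\<^esub> m = \<one>\<^bsub>W m\<^esub>"
    unfolding w_pow by (rule relator_one) (simp add: relators_def)
  moreover have "w m [S2, S1] = inv\<^bsub>W m\<^esub> (w m [S1, S2])" by (simp add: inv_w)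
  ultimately show "w m [S2, S1] [^]\<^bsub>W m\<^esub> m = \<one>\<^bsub>W m\<^esub>" by (simp add: nat_pow_inv)
qed

lemma s_path_ceil_gaps:
  assumes "b > 0"
  shows "s_path m a b = list_prod (W m)
    (map (\<lambda>x. w m [S2, S3] [^]\<^bsub>W m\<^esub> x \<otimes>\<^bsub>W m\<^esub> w m [S2, S1]) (ceil_gaps a b))"
  unfolding s_path_def dyck_path_ceil_gaps[OF assms]
  by (subst group.list_prod_concat_blocks[OF group_W]) simp_all

text \<open>
  Since \<open>23\<close> has order dividing \<open>m\<close>, the entries \<open>m\<close> and \<open>m - 1\<close> contribute \<open>21\<close> and
  \<open>(23)\<^sup>-\<^sup>1 21 = 3221 = 31\<close>.
\<close>

lemma s_path_reflect:
  assumes m: "m \<ge> 1" and b: "b > 0" and gaps: "ceil_gaps a b = blocks (m - 1) xs"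
  shows "s_path m a b = list_prod (W m)
    (map (\<lambda>x. w m [S2, S1] [^]\<^bsub>W m\<^esub> (x - 1) \<otimes>\<^bsub>W m\<^esub> w m [S3, S1]) xs)"
proof -
  interpret group "W m" by (rule group_W)
  let ?f = "\<lambda>x. w m [S2, S3] [^]\<^bsub>W m\<^esub> x \<otimes>\<^bsub>W m\<^esub> w m [S2, S1]"
  have 1: "?f (Suc (m - 1)) = w m [S2, S1]" using m by (simp add: rotation_orders)
  have "w m [S2, S3] [^]\<^bsub>W m\<^esub> (m - 1) = w m [S3, S2]"
    using pow_pred_eq_inv[OF w_closed rotation_orders(1) m] by (simp add: inv_w)
  then have 2: "?f (m - 1) = w m [S3, S1]"
    by (simp add: w_Cons w_Nil m_assoc s_cancel)
  show ?thesis unfolding s_path_ceil_gaps[OF b] gaps blocks_def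
    by (subst list_prod_concat_blocks) (simp_all only: 1 2 m_closed nat_pow_closed w_closed)
qed

text \<open>
  After two reflections the factors are \<open>(21)\<^sup>m\<^sup>-\<^sup>1 31 = 1231\<close> and \<open>(21)\<^sup>m\<^sup>-\<^sup>2 31 = 121231\<close>.  Conjugation by
  \<open>132\<close> takes \<open>23\<close> to the former and \<open>23 21\<close> to the latter, so a block of length \<open>x\<close> becomes the
  conjugate of \<open>(23)\<^sup>x 21\<close>, the contribution of an entry \<open>x\<close> to a path element.
\<close>

lemma s_path_reflect_twice:
  assumes m: "m \<ge> 2" and pos: "b > 0" "d > 0" "d \<le> c"
    and gaps: "ceil_gaps a b = blocks (m - 1) (ceil_gaps b c)"
      "ceil_gaps b c = blocks (m - 1) (ceil_gaps c d)"
  shows "s_path m a b =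
    w m [S1, S3, S2] \<otimes>\<^bsub>W m\<^esub> s_path m c d \<otimes>\<^bsub>W m\<^esub> w m [S2, S3, S1]"
proof -
  interpret group "W m" by (rule group_W)
  let ?x = "w m [S2, S3]" and ?y = "w m [S2, S1]" and ?g = "w m [S1, S3, S2]"
  let ?h = "\<lambda>x. ?y [^]\<^bsub>W m\<^esub> (x - 1) \<otimes>\<^bsub>W m\<^esub> w m [S3, S1]"
  have g: "inv\<^bsub>W m\<^esub> ?g = w m [S2, S3, S1]" by (simp add: inv_w)
  have y1: "?y [^]\<^bsub>W m\<^esub> (m - 1) = w m [S1, S2]"
    using pow_pred_eq_inv[OF w_closed rotation_orders(2)] m by (simp add: inv_w)
  have "?y [^]\<^bsub>W m\<^esub> (m - 2) = ?y [^]\<^bsub>W m\<^esub> (m - 2) \<otimes>\<^bsub>W m\<^esub> ?y \<otimes>\<^bsub>W m\<^esub> w m [S1, S2]"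
    by (simp add: w_Cons w_Nil m_assoc s_cancel s_square)
  also have "?y [^]\<^bsub>W m\<^esub> (m - 2) \<otimes>\<^bsub>W m\<^esub> ?y = ?y [^]\<^bsub>W m\<^esub> Suc (m - 2)" by simp
  also have "Suc (m - 2) = m - 1" using m by simp
  finally have y2: "?y [^]\<^bsub>W m\<^esub> (m - 1 - 1) = w m [S1, S2] \<otimes>\<^bsub>W m\<^esub> w m [S1, S2]"
    by (simp only: y1 diff_diff_left one_add_one)
  have hm: "?h (Suc (m - 1)) = ?g \<otimes>\<^bsub>W m\<^esub> ?x \<otimes>\<^bsub>W m\<^esub> inv\<^bsub>W m\<^esub> ?g"
    unfolding g diff_Suc_1 y1 by (simp add: w_Cons w_Nil m_assoc s_cancel)
  have hm1: "?h (m - 1) = ?g \<otimes>\<^bsub>W m\<^esub> (?x \<otimes>\<^bsub>W m\<^esub> ?y) \<otimes>\<^bsub>W m\<^esub> inv\<^bsub>W m\<^esub> ?g"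
    unfolding g y2 by (simp add: w_Cons w_Nil m_assoc s_cancel)
  have block: "?h (Suc (m - 1)) [^]\<^bsub>W m\<^esub> (x - 1) \<otimes>\<^bsub>W m\<^esub> ?h (m - 1) =
      ?g \<otimes>\<^bsub>W m\<^esub> (?x [^]\<^bsub>W m\<^esub> x \<otimes>\<^bsub>W m\<^esub> ?y) \<otimes>\<^bsub>W m\<^esub> inv\<^bsub>W m\<^esub> ?g" if "x \<ge> 1" for x :: nat
  proof -
    have "inv\<^bsub>W m\<^esub> ?g \<otimes>\<^bsub>W m\<^esub> (?g \<otimes>\<^bsub>W m\<^esub> z) = z" if "z \<in> carrier (W m)" for z
      using that by (simp flip: m_assoc)
    moreover have "?x [^]\<^bsub>W m\<^esub> x = ?x [^]\<^bsub>W m\<^esub> (x - 1) \<otimes>\<^bsub>W m\<^esub> ?x"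
      using that by (cases x) auto
    ultimately show ?thesis 
      unfolding hm hm1 conj_nat_pow[OF w_closed w_closed] by (simp add: m_assoc)
  qed
  have ge: "x \<ge> 1" if "x \<in> set (ceil_gaps c d)" for x
    using ceil_gaps_ge[OF _ _ that, of 1] pos by simp
  have "s_path m a b = list_prod (W m) (map ?h (blocks (m - 1) (ceil_gaps c d)))"
    using s_path_reflect[OF _ pos(1) gaps(1)] m gaps(2) by simp
  also have "\<dots> = list_prod (W m) (map (\<lambda>x. ?h (Suc (m - 1)) [^]\<^bsub>W m\<^esub> (x - 1) \<otimes>\<^bsub>W m\<^esub> ?h (m - 1))
      (ceil_gaps c d))"
    unfolding blocks_def by (subst list_prod_concat_blocks) simp_all
  also have "\<dots> = list_prod (W m) (map (\<lambda>x. ?g \<otimes>\<^bsub>W m\<^esub> (?x [^]\<^bsub>W m\<^esub> x \<otimes>\<^bsub>W m\<^esub> ?y) \<otimes>\<^bsub>W m\<^esub> inv\<^bsub>W m\<^esub> ?g)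
      (ceil_gaps c d))"
    by (intro arg_cong[where f = "list_prod (W m)"] map_cong HOL.refl block ge)
  also have "\<dots> = ?g \<otimes>\<^bsub>W m\<^esub> s_path m c d \<otimes>\<^bsub>W m\<^esub> inv\<^bsub>W m\<^esub> ?g"
    unfolding s_path_ceil_gaps[OF pos(2)] by (rule list_prod_conj) simp_all
  finally show ?thesis unfolding g .
qed


section \<open>Descent\<close>

text \<open>
  In applications \<open>[p, q]\<close> is the \<open>(k - 1)\<close>-fold reflection of \<open>[a, b]\<close>.  The first stage is set
  apart because it is the only one whose entries are not lowered.
\<close>

definition governs :: "nat \<Rightarrow> nat \<Rightarrow> nat \<Rightarrow> nat \<Rightarrow> nat \<Rightarrow> bool" where
  "governs a b k p q \<longleftrightarrow>
     (if k = 1 then p = a \<and> q = b else canonical_data a b k = Some (shifted_data p q))"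

lemma governs_step:
  assumes "governs a b k p q" "k \<ge> 1" "p + c = m * q" "2 * c < q" "c > 0" "m \<ge> 2"
  shows "governs a b (Suc k) q c"
proof (cases "k = 1")
  case True
  with assms canonical_data_2[of p c m q] show ?thesis
    by (simp add: governs_def numeral_2_eq_2)
next
  case False
  then obtain n where "k = Suc n" using assms(2) by (cases k) auto
  with False assms canonical_data_shift_step[of a b n p q c m] show ?thesis
    by (simp add: governs_def)
qed

text \<open>
  Two reflections at a time, so that each step is a conjugation by \<open>132\<close>.  The new conjugating
  factors arise innermost, which is why the induction peels the last two reflections off.
\<close>

lemma descent:
  assumes m: "m \<ge> 2" and "root_of_level m a b (2 * l + n)" "n \<ge> 1"
  obtains p q where "root_of_level m p q n" "governs a b (2 * l + 1) p q"
    "s_path m a b = w m [S1, S3, S2] [^]\<^bsub>W m\<^esub> l \<otimes>\<^bsub>W m\<^esub> s_path m p q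
       \<otimes>\<^bsub>W m\<^esub> w m [S2, S3, S1] [^]\<^bsub>W m\<^esub> l"
  using assms(2,3)
proof (induction l arbitrary: n thesis)
  case 0
  interpret group "W m" by (rule group_W)
  have "s_path m a b \<in> carrier (W m)"
    unfolding s_path_def by (rule list_prod_closed) auto
  with 0 show ?case by (auto simp: governs_def)
next
  case (Suc l)
  interpret group "W m" by (rule group_W)
  obtain p q where pq: "root_of_level m p q (n + 2)" "governs a b (2 * l + 1) p q"
    "s_path m a b = w m [S1, S3, S2] [^]\<^bsub>W m\<^esub> l \<otimes>\<^bsub>W m\<^esub> s_path m p q
       \<otimes>\<^bsub>W m\<^esub> w m [S2, S3, S1] [^]\<^bsub>W m\<^esub> l"
    using Suc.IH[of "n + 2"] Suc.prems by auto
  obtain c where c: "p + c = m * q" "2 * c < q" "root_of_level m q c (Suc n)"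
    using reflect_root[OF m, of p q "Suc n"] pq(1) by auto
  obtain d where d: "q + d = m * c" "2 * d < c" "root_of_level m c d n"
    using reflect_root[OF m c(3) \<open>n \<ge> 1\<close>] by blast
  note pos = root_of_level_pos[OF pq(1)] root_of_level_pos[OF c(3)] root_of_level_pos[OF d(3)]
  have "governs a b (Suc (2 * l + 1)) q c" using pq(2) c m pos by (intro governs_step) auto
  then have gov: "governs a b (Suc (Suc (2 * l + 1))) c d" 
    using governs_step[of a b _ q c d m] d m pos by simp
  have "s_path m p q = w m [S1, S3, S2] \<otimes>\<^bsub>W m\<^esub> s_path m c d \<otimes>\<^bsub>W m\<^esub> w m [S2, S3, S1]"
    using m c d pos by (intro s_path_reflect_twice ceil_gaps_reflect_root(1)) auto
  moreover have "s_path m c d \<in> carrier (W m)"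
    unfolding s_path_def by (rule list_prod_closed) auto
  ultimately have "s_path m a b = w m [S1, S3, S2] [^]\<^bsub>W m\<^esub> Suc l \<otimes>\<^bsub>W m\<^esub> s_path m c d
       \<otimes>\<^bsub>W m\<^esub> w m [S2, S3, S1] [^]\<^bsub>W m\<^esub> Suc l"
    unfolding pq(3) nat_pow_Suc2[OF w_closed[of m "[S2, S3, S1]"]] by (simp add: m_assoc)
  with gov d(3) show ?case using Suc.prems(1)[of c d] by simp
qed

theorem corollary4p17:
  fixes m a b L k :: nat
  assumes "m \<ge> 2"
    and "imaginary_reduced_positive_root m a b" and "a \<ge> b"
    and "level m a b = L" and "L \<ge> 2"
    and "2 \<le> k" and "k \<le> L"
  shows "\<exists>c. canonical_seq a b k = Some c \<and>
    (\<forall>l. k = 2 * l + 2 \<longrightarrow>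
       s_path m a b =
         w m [S1, S3, S2] [^]\<^bsub>W m\<^esub> l
         \<otimes>\<^bsub>W m\<^esub> list_prod (W m) (map (\<lambda>x. w m [S2, S1] [^]\<^bsub>W m\<^esub> x \<otimes>\<^bsub>W m\<^esub> w m [S3, S1]) c)
         \<otimes>\<^bsub>W m\<^esub> w m [S2, S3, S1] [^]\<^bsub>W m\<^esub> l) \<and>
    (\<forall>l. k = 2 * l + 1 \<longrightarrow>
       s_path m a b =
         w m [S1, S3, S2] [^]\<^bsub>W m\<^esub> l
         \<otimes>\<^bsub>W m\<^esub> list_prod (W m) (map (\<lambda>x. w m [S2, S3] [^]\<^bsub>W m\<^esub> (x + 1) \<otimes>\<^bsub>W m\<^esub> w m [S2, S1]) c)
         \<otimes>\<^bsub>W m\<^esub> w m [S2, S3, S1] [^]\<^bsub>W m\<^esub> l \<and>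
       (\<exists>a' b'. imaginary_reduced_positive_root m a' b' \<and> a' \<ge> b' \<and>
          canonical_seq a' b' 1 = Some (map (\<lambda>x. x + 1) c) \<and>
          level m a' b' = L - k + 1 \<and>
          w m [S2, S3, S1] [^]\<^bsub>W m\<^esub> l \<otimes>\<^bsub>W m\<^esub> s_path m a b \<otimes>\<^bsub>W m\<^esub> w m [S1, S3, S2] [^]\<^bsub>W m\<^esub> l
            = s_path m a' b'))"
proof -
  interpret group "W m" by (rule group_W)
  let ?g = "w m [S1, S3, S2]" and ?g' = "w m [S2, S3, S1]"
  have root: "root_of_level m a b L" using root_of_level_level assms by blast
  \<comment> \<open>For both parities of \<open>k\<close> this is the exponent: \<open>k = 2 l + 2\<close> or \<open>k = 2 l + 1\<close>.\<close>
  define l where l: "l = (k - 1) div 2"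
  have n: "L = 2 * l + (L - 2 * l)" "L - 2 * l \<ge> 1" using assms l by auto
  obtain p q where pq: "root_of_level m p q (L - 2 * l)" "governs a b (2 * l + 1) p q"
    "s_path m a b = ?g [^]\<^bsub>W m\<^esub> l \<otimes>\<^bsub>W m\<^esub> s_path m p q \<otimes>\<^bsub>W m\<^esub> ?g' [^]\<^bsub>W m\<^esub> l"
    using descent[of m a b l "L - 2 * l"] root n assms(1) by metis
  note pos = root_of_level_pos[OF pq(1)]
  show ?thesis
  proof (cases "even k")
    case True
    then have k: "k = 2 * l + 2" using l assms by auto
    then have "root_of_level m p q (Suc (L - 2 * l - 1))" "L - 2 * l - 1 \<ge> 1"
      using pq(1) assms by (simp_all add: Suc_diff_Suc)
    then obtain c where c: "p + c = m * q" "2 * c < q" "root_of_level m q c (L - 2 * l - 1)"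
      using reflect_root[OF assms(1)] by blast
    note posc = root_of_level_pos[OF c(3)]
    have "governs a b (Suc (2 * l + 1)) q c"
      using governs_step[OF pq(2) _ c(1,2)] posc assms(1) by simp
    then have seq: "canonical_seq a b k = Some (map (\<lambda>x. x - 1) (ceil_gaps q c))"
      by (simp add: governs_def canonical_seq_def shifted_data_def k)
    have "ceil_gaps p q = blocks (m - 1) (ceil_gaps q c)"
      using c posc assms(1) by (intro ceil_gaps_reflect_root) auto
    then have s: "s_path m p q = list_prod (W m) (map (\<lambda>x. w m [S2, S1] [^]\<^bsub>W m\<^esub> x \<otimes>\<^bsub>W m\<^esub> w m [S3, S1])
        (map (\<lambda>x. x - 1) (ceil_gaps q c)))"
      using assms(1) pos by (simp add: s_path_reflect o_def)
    show ?thesis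
    proof (intro exI[of _ "map (\<lambda>x. x - 1) (ceil_gaps q c)"] conjI allI impI)
      fix l' assume "k = 2 * l' + 2"
      then have l': "l' = l" using k by simp
      show "s_path m a b = ?g [^]\<^bsub>W m\<^esub> l' \<otimes>\<^bsub>W m\<^esub>
          list_prod (W m) (map (\<lambda>x. w m [S2, S1] [^]\<^bsub>W m\<^esub> x \<otimes>\<^bsub>W m\<^esub> w m [S3, S1])
            (map (\<lambda>x. x - 1) (ceil_gaps q c))) \<otimes>\<^bsub>W m\<^esub> ?g' [^]\<^bsub>W m\<^esub> l'"
        unfolding l' pq(3) s ..
    next
      show "canonical_seq a b k = Some (map (\<lambda>x. x - 1) (ceil_gaps q c))" by (rule seq)
    qed (use True in simp_all)
  next
    case False
    then have k: "k = 2 * l + 1" "l \<ge> 1" using l assms by (auto elim!: oddE)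
    define c where "c = map (\<lambda>x. x - 1) (ceil_gaps p q)"
    have seq: "canonical_seq a b k = Some c"
      using pq(2) k by (simp add: governs_def canonical_seq_def shifted_data_def c_def)
    have suc: "map (\<lambda>x. x + 1) c = ceil_gaps p q"
    proof -
      have "x - 1 + 1 = x" if "x \<in> set (ceil_gaps p q)" for x
        using ceil_gaps_ge[OF _ _ that, of 1] pos by simp
      then show ?thesis unfolding c_def map_map o_def by (rule map_idI)
    qed
    have s: "s_path m p q = list_prod (W m)
        (map (\<lambda>x. w m [S2, S3] [^]\<^bsub>W m\<^esub> (x + 1) \<otimes>\<^bsub>W m\<^esub> w m [S2, S1]) c)"
      using pos unfolding s_path_ceil_gaps[of q, OF conjunct1[OF conjunct2[OF pos]]] suc[symmetric]
      by (simp only: map_map o_def)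
    have closed: "s_path m p q \<in> carrier (W m)"
      unfolding s_path_def by (rule list_prod_closed) auto
    have "?g' = inv\<^bsub>W m\<^esub> ?g" by (simp add: inv_w)
    then have "?g' [^]\<^bsub>W m\<^esub> l = inv\<^bsub>W m\<^esub> (?g [^]\<^bsub>W m\<^esub> l)" by (simp add: nat_pow_inv)
    then have conj: "?g' [^]\<^bsub>W m\<^esub> l \<otimes>\<^bsub>W m\<^esub> s_path m a b \<otimes>\<^bsub>W m\<^esub> ?g [^]\<^bsub>W m\<^esub> l = s_path m p q"
      using closed unfolding pq(3) by (simp add: m_assoc) (simp flip: m_assoc)
    have "canonical_seq p q 1 = Some (map (\<lambda>x. x + 1) c)"
      using pos unfolding suc by (simp add: canonical_seq_def h_lengths_dyck_path Let_def)
    moreover have "level m p q = L - k + 1"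
      using level_eq[OF assms(1) pq(1)] k assms by simp
    moreover have "imaginary_reduced_positive_root m p q" using pq(1) by (simp add: root_of_level_def)
    ultimately have ex: "\<exists>a' b'. imaginary_reduced_positive_root m a' b' \<and> a' \<ge> b' \<and>
          canonical_seq a' b' 1 = Some (map (\<lambda>x. x + 1) c) \<and> level m a' b' = L - k + 1 \<and>
          ?g' [^]\<^bsub>W m\<^esub> l \<otimes>\<^bsub>W m\<^esub> s_path m a b \<otimes>\<^bsub>W m\<^esub> ?g [^]\<^bsub>W m\<^esub> l = s_path m a' b'"
      using conj pos by blast
    show ?thesis
    proof (intro exI[of _ c] conjI[OF seq] conjI[of "All _" "All _"] allI impI)
      fix l' assume "k = 2 * l' + 1"
      then have l': "l' = l" using k by simp
      have "s_path m a b = ?g [^]\<^bsub>W m\<^esub> l' \<otimes>\<^bsub>W m\<^esub>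
          list_prod (W m) (map (\<lambda>x. w m [S2, S3] [^]\<^bsub>W m\<^esub> (x + 1) \<otimes>\<^bsub>W m\<^esub> w m [S2, S1]) c)
          \<otimes>\<^bsub>W m\<^esub> ?g' [^]\<^bsub>W m\<^esub> l'"
        unfolding l' pq(3) s ..
      from conjI[OF this ex[folded l']] show "s_path m a b = ?g [^]\<^bsub>W m\<^esub> l' \<otimes>\<^bsub>W m\<^esub>
          list_prod (W m) (map (\<lambda>x. w m [S2, S3] [^]\<^bsub>W m\<^esub> (x + 1) \<otimes>\<^bsub>W m\<^esub> w m [S2, S1]) c)
          \<otimes>\<^bsub>W m\<^esub> ?g' [^]\<^bsub>W m\<^esub> l' \<and>
        (\<exists>a' b'. imaginary_reduced_positive_root m a' b' \<and> a' \<ge> b' \<and>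
          canonical_seq a' b' 1 = Some (map (\<lambda>x. x + 1) c) \<and> level m a' b' = L - k + 1 \<and>
          ?g' [^]\<^bsub>W m\<^esub> l' \<otimes>\<^bsub>W m\<^esub> s_path m a b \<otimes>\<^bsub>W m\<^esub> ?g [^]\<^bsub>W m\<^esub> l' = s_path m a' b')" .
    qed (use False in simp_all)
  qed
qed

end
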